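(* Let $n,d\ge 1$ be integers, let $m>0$, and let $(X,Y)$ be a random pair in $\mathbf{R}^d\times\mathbf{R}$ with arbitrary distribution of $X$ and with $\sup_{x\in\mathbf{R}^d}\mathbf{E}[Y^2\mid X=x]\le m^2$. Let $\widehat g_m$ be the truncated least squares estimator (at level $m$) computed on an i.i.d. sample $S_n=(X_i,Y_i)_{i=1}^n$ of copies of $(X,Y)$. Then $$\mathbf{E}\,R(\widehat g_m)-\inf_{f\in\mathcal{F}_{\mathrm{lin}}}R(f)\;\le\;\frac{8m^2d}{n+1},$$ where the expectation is over the sample $S_n$.
   Context: For measurable $g:\mathbf{R}^d\to\mathbf{R}$ the risk is $R(g)=\mathbf{E}(g(X)-Y)^2$, where $(X,Y)$ is independent of the sample; for a data-dependent $\widehat g$, $R(\widehat g)$ is the (random) risk conditional on the sample. $\mathcal{F}_{\mathrm{lin}}=\{x\mapsto\langle w,x\rangle: w\in\mathbf{R}^d\}$ is the class of linear functions. No assumption is made on the distribution of $X$ (in particular, no moments are assumed). The least squares solution is $\widehat w_{\mathrm{erm}}=\big(\sum_{i=1}^nX_iX_i^{\mathsf T}\big)^{\dagger}\big(\sum_{i=1}^nY_iX_i\big)$, where $\dagger$ is the Moore–Penrose inverse. The truncated least squares estimator at level $m$ is the predictor $\widehat g_m(x)=\max(-m,\min(m,\langle\widehat w_{\mathrm{erm}},x\rangle))$. *)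

theory Defs
  imports "HOL-Probability.Probability"
begin

definition is_moore_penrose :: "real^'n^'m \<Rightarrow> real^'m^'n \<Rightarrow> bool" where
  "is_moore_penrose A B \<longleftrightarrow>
     A ** B ** A = A \<and> B ** A ** B = B \<and>
     transpose (A ** B) = A ** B \<and> transpose (B ** A) = B ** A"

lemma is_moore_penrose_unique:
  assumes "is_moore_penrose A B" "is_moore_penrose A C"
  shows "B = C"
proof -
  note B = assms(1)[unfolded is_moore_penrose_def]
  note C = assms(2)[unfolded is_moore_penrose_def]
  have "A ** B = transpose (A ** B)" using B by simp
  also have "\<dots> = transpose ((A ** C) ** (A ** B))"
    using C by (simp add: matrix_mul_assoc)
  also have "\<dots> = (A ** B) ** (A ** C)"
    using B C by (simp add: matrix_transpose_mul del: matrix_mul_assoc)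
  also have "\<dots> = A ** C" using B by (simp add: matrix_mul_assoc)
  finally have AB: "A ** B = A ** C" .
  have "B ** A = transpose (B ** A)" using B by simp
  also have "\<dots> = transpose ((B ** A) ** (C ** A))"
    using C by (metis matrix_mul_assoc)
  also have "\<dots> = (C ** A) ** (B ** A)"
    using B C by (metis matrix_transpose_mul)
  also have "\<dots> = C ** A" using B by (metis matrix_mul_assoc)
  finally have BA: "B ** A = C ** A" .
  show ?thesis using AB BA B C by (metis matrix_mul_assoc)
qed

definition moore_penrose :: "real^'n^'m \<Rightarrow> real^'m^'n" where
  "moore_penrose A = (THE B. is_moore_penrose A B)"

definition erm_coeff :: "nat \<Rightarrow> (nat \<Rightarrow> real^'d) \<Rightarrow> (nat \<Rightarrow> real) \<Rightarrow> real^'d" where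
  "erm_coeff n x y =
     moore_penrose (\<Sum>i=1..n. columnvector (x i) ** (rowvector (x i) :: real^'d^1)) *v (\<Sum>i=1..n. y i *\<^sub>R x i)"

definition truncated_ls ::
  "real \<Rightarrow> nat \<Rightarrow> (nat \<Rightarrow> real^'d) \<Rightarrow> (nat \<Rightarrow> real) \<Rightarrow> real^'d \<Rightarrow> real" where
  "truncated_ls m n x y z = max (- m) (min m (erm_coeff n x y \<bullet> z))"

definition linear_class :: "(real^'d \<Rightarrow> real) set" where
  "linear_class = range (\<lambda>w x. w \<bullet> x)"

text \<open>The risk takes values in the extended nonnegative reals: as no moments of the
  covariates are assumed, some linear functions may have infinite risk.\<close>

definition risk ::
  "'a measure \<Rightarrow> ('a \<Rightarrow> real^'d) \<Rightarrow> ('a \<Rightarrow> real) \<Rightarrow> (real^'d \<Rightarrow> real) \<Rightarrow> ennreal" where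
  "risk M X Y g = (\<integral>\<^sup>+ \<omega>. ennreal ((g (X \<omega>) - Y \<omega>)\<^sup>2) \<partial>M)"

text \<open>\<open>cond_exp_version M X f \<phi>\<close> states that \<open>\<phi>\<close> is a version of the function
  mapping \<open>x\<close> to the conditional expectation of the nonnegative variable \<open>f\<close> given \<open>X = x\<close>;
  such a function is determined up to null sets of the law of \<open>X\<close>. The real-valued
  conditional expectation \<^const>\<open>real_cond_exp\<close> would be unsuitable here: it replaces the value
  infinity by 0.\<close>

definition cond_exp_version ::
  "'a measure \<Rightarrow> ('a \<Rightarrow> real^'d) \<Rightarrow> ('a \<Rightarrow> ennreal) \<Rightarrow> (real^'d \<Rightarrow> ennreal) \<Rightarrow> bool" where
  "cond_exp_version M X f \<phi> \<longleftrightarrow>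
     \<phi> \<in> borel_measurable borel \<and>
     (AE \<omega> in M. nn_cond_exp M (vimage_algebra (space M) X borel) f \<omega> = \<phi> (X \<omega>))"

end

theory Submission
  imports Defs
begin

text \<open>Add the test pair to the sample as observation number 0. By exchangeability the expected
  risk is the average over \<open>i\<close> of the expected leave-one-out losses of the truncated estimator. With
  \<open>h\<^sub>i\<close> the leverage of observation \<open>i\<close> in the extended sample, the least squares residual on that
  sample is \<open>1 - h\<^sub>i\<close> times the untruncated leave-one-out residual. Since \<open>E[Y\<^sup>2 | X] \<le> m\<^sup>2\<close>,
  truncation does not increase the conditional expected loss, and replacing the factor \<open>(1 - h\<^sub>i)\<^sup>2\<close> by 1
  costs at most \<open>2 h\<^sub>i \<cdot> 4 m\<^sup>2\<close>. Summing, the leverages add up to at most \<open>d\<close>, being the diagonal of a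
  projection, and the least squares residuals are dominated by those of any fixed linear function.\<close>

subsection \<open>Gram matrices, leverages and least squares\<close>

definition gram :: "'i set \<Rightarrow> ('i \<Rightarrow> real^'d) \<Rightarrow> real^'d^'d" where
  "gram J x = (\<Sum>j\<in>J. columnvector (x j) ** (rowvector (x j) :: real^'d^1))"

lemma gram_nth: "gram J x $ k $ l = (\<Sum>j\<in>J. x j $ k * x j $ l)"
  by (simp add: gram_def columnvector_def rowvector_def matrix_matrix_mult_def)

lemma transpose_gram [simp]: "transpose (gram J x) = gram J x"
  by (simp add: vec_eq_iff transpose_def gram_nth mult.commute)

lemma gram_mult_vec: "gram J x *v u = (\<Sum>j\<in>J. (x j \<bullet> u) *\<^sub>R x j)"
proof -
  have "(\<Sum>l\<in>UNIV. (\<Sum>j\<in>J. x j $ k * x j $ l) * u $ l) = (\<Sum>j\<in>J. (\<Sum>l\<in>UNIV. x j $ l * u $ l) * x j $ k)" for k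
    by (simp add: sum_distrib_right sum_distrib_left sum.swap[of _ J] mult_ac)
  then show ?thesis
    by (simp add: vec_eq_iff matrix_vector_mult_def gram_nth inner_vec_def)
qed

lemma inner_gram_mult: "v \<bullet> (gram J x *v u) = (\<Sum>j\<in>J. (x j \<bullet> v) * (x j \<bullet> u))"
  by (simp add: gram_mult_vec inner_sum_right mult.commute inner_commute)

lemma inner_symmetric_matrix:
  fixes A :: "real^'n^'n"
  assumes "transpose A = A"
  shows "(A *v u) \<bullet> v = u \<bullet> (A *v v)"
  using assms by (metis dot_lmul_matrix vector_transpose_matrix)

lemma gram_insert:
  assumes "finite J" "i \<notin> J"
  shows "gram (insert i J) x *v u = (x i \<bullet> u) *\<^sub>R x i + gram J x *v u"
  using assms by (simp add: gram_mult_vec)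

section \<open>Orthogonal projections and pseudoinverses of symmetric matrices\<close>

text \<open>For an orthonormal basis \<open>B\<close> of \<open>S\<close> the projection is the sum
  of the matrices b b^T over \<open>B\<close>, which is \<open>gram B (\<lambda>b. b)\<close>; its
  symmetry is that of every Gram matrix.\<close>

lemma orthogonal_projection_matrix_exists:
  fixes S :: "(real^'n) set"
  assumes "subspace S"
  obtains P :: "real^'n^'n" where "transpose P = P" "\<And>u. P *v u \<in> S" "\<And>u. u \<in> S \<Longrightarrow> P *v u = u"
proof -
  obtain B where B: "B \<subseteq> S" "pairwise orthogonal B" "\<And>x. x \<in> B \<Longrightarrow> norm x = 1"
    "independent B" "span B = S"
    using orthonormal_basis_subspace[OF assms] by metis
  have fin: "finite B" using B(4) independent_imp_finite by blast
  have "gram B (\<lambda>b. b) *v u = u" if "u \<in> S" for u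
  proof -
    have *: "gram B (\<lambda>b. b) *v b = id b" if b: "b \<in> B" for b
    proof -
      have "gram B (\<lambda>b. b) *v b = (\<Sum>c\<in>B. (if c = b then b else 0))"
        unfolding gram_mult_vec
      proof (rule sum.cong)
        fix c assume c: "c \<in> B"
        show "(c \<bullet> b) *\<^sub>R c = (if c = b then b else 0)"
          using B(2) B(3)[OF b] b c by (auto simp: pairwise_def orthogonal_def norm_eq_1)
      qed simp
      then show ?thesis using fin b by simp
    qed
    have "gram B (\<lambda>b. b) *v u = id u"
      by (rule linear_eq_on_span[OF matrix_vector_mul_linear linear_id *]) (use that B(5) in auto)
    then show ?thesis by simp
  qed
  moreover have "gram B (\<lambda>b. b) *v u \<in> S" for u
    unfolding gram_mult_vec using B(1) by (auto intro!: subspace_sum[OF assms] subspace_scale[OF assms])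
  ultimately show thesis using that[of "gram B (\<lambda>b. b)"] by simp
qed

text \<open>No spectral decomposition is used. With \<open>P\<close> the orthogonal projection onto
  the range of \<open>A\<close>, the matrix \<open>C = A + (mat 1 - P)\<close> acts as
  \<open>A\<close> on the range and as the identity on its orthogonal complement, which is the
  kernel of \<open>A\<close>. So \<open>C\<close> is invertible, and its inverse \<open>D\<close>,
  cut down to the range, is the pseudoinverse \<open>D ** P\<close>.\<close>

lemma symmetric_moore_penrose_exists:
  fixes A :: "real^'n^'n"
  assumes sym: "transpose A = A"
  shows "\<exists>G. is_moore_penrose A G"
proof -
  have "subspace (range ((*v) A))"
    by (rule linear_subspace_image[OF matrix_vector_mul_linear subspace_UNIV])
  then obtain P where P: "transpose P = P" "\<And>u. P *v u \<in> range ((*v) A)"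
      "\<And>u. u \<in> range ((*v) A) \<Longrightarrow> P *v u = u"
    using orthogonal_projection_matrix_exists by blast
  have PA: "P ** A = A"
    by (simp add: matrix_eq matrix_vector_mul_assoc[symmetric] P)
  have PP: "P ** P = P"
    by (simp add: matrix_eq matrix_vector_mul_assoc[symmetric] P)
  have AP: "A ** P = A"
    by (metis PA P(1) sym matrix_transpose_mul)
  have APv: "A *v (P *v u) = A *v u" for u
    by (simp add: matrix_vector_mul_assoc AP)
  define C where "C = A + (mat 1 - P)"
  have CP: "C ** P = A" and PC: "P ** C = A"
    by (simp_all add: C_def matrix_eq matrix_vector_mul_assoc[symmetric] matrix_vector_mult_add_rdistrib
        matrix_vector_mult_diff_rdistrib matrix_vector_right_distrib matrix_vector_mult_diff_distrib P APv)
  \<comment> \<open>Applying \<open>P\<close> shows that \<open>u\<close> is in the kernel of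
    \<open>A\<close>; then \<open>C *v u = 0\<close> reduces to \<open>u = P *v u\<close>, so
    \<open>u\<close> is also in the range of \<open>A\<close>. By symmetry these spaces are
    orthogonal, hence \<open>u\<close> is orthogonal to itself.\<close>
  have "u = 0" if "C *v u = 0" for u
  proof -
    have Au: "A *v u = 0"
      by (metis PC matrix_vector_mul_assoc matrix_vector_mult_0_right that)
    then have u: "u = P *v u"
      using that by (simp add: C_def matrix_vector_mult_add_rdistrib matrix_vector_mult_diff_rdistrib)
    obtain t where "P *v u = A *v t" using P(2) by blast
    then have "u \<bullet> u = (A *v u) \<bullet> t"
      using u inner_symmetric_matrix[OF sym, of u t] by simp
    then show ?thesis using Au by simp
  qed
  then obtain D where DC: "D ** C = mat 1"
    using matrix_left_invertible_ker by blast
  then have CD: "C ** D = mat 1"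
    using matrix_left_right_inverse by blast
  have DA: "D ** A = P"
    by (metis CP DC matrix_mul_assoc matrix_mul_lid)
  have AD: "A ** D = P"
    by (metis PC CD matrix_mul_assoc matrix_mul_rid)
  have PD: "P ** D = D ** P"
    by (metis DA AD matrix_mul_assoc)
  have "A ** (D ** P) = P" "(D ** P) ** A = P"
    by (metis AD PP matrix_mul_assoc, metis DA PA matrix_mul_assoc)
  moreover have "P ** (D ** P) = D ** P"
    by (metis PD PP matrix_mul_assoc)
  ultimately have "is_moore_penrose A (D ** P)"
    by (simp add: is_moore_penrose_def PA P(1))
  then show ?thesis by blast
qed

lemma is_moore_penrose_moore_penrose:
  fixes A :: "real^'n^'n"
  assumes "transpose A = A"
  shows "is_moore_penrose A (moore_penrose A)"
proof -
  have "\<exists>!G. is_moore_penrose A G"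
    using symmetric_moore_penrose_exists[OF assms] is_moore_penrose_unique by blast
  then show ?thesis unfolding moore_penrose_def by (rule theI')
qed

text \<open>For the pseudoinverse G, the symmetry of G A and of A gives G = (G A) G = A G^T
  G.\<close>

lemma moore_penrose_in_range:
  fixes A :: "real^'n^'n"
  assumes "transpose A = A"
  shows "moore_penrose A *v b \<in> range ((*v) A)"
proof -
  let ?G = "moore_penrose A"
  have G: "?G ** A ** ?G = ?G" "transpose (?G ** A) = ?G ** A"
    using is_moore_penrose_moore_penrose[OF assms] by (simp_all add: is_moore_penrose_def)
  have "?G = A ** (transpose ?G ** ?G)"
    by (metis G assms matrix_mul_assoc matrix_transpose_mul)
  then have "?G *v b = A *v ((transpose ?G ** ?G) *v b)"
    by (metis matrix_vector_mul_assoc)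
  then show ?thesis by blast
qed

text \<open>\<open>?P\<close> is the orthogonal projection onto the range of the Gram matrix, so the
  point is that \<open>x i\<close> lies in that range. The component \<open>e\<close> left over by
  the projection is in the kernel of the Gram matrix; the quadratic form at \<open>e\<close> is the
  sum of the squares of \<open>x j \<bullet> e\<close>, so \<open>e\<close> is orthogonal to
  \<open>x i\<close>. It is orthogonal to the projected part as well, hence zero.\<close>

lemma gram_moore_penrose_mult:
  assumes "finite J" "i \<in> J"
  shows "gram J x *v (moore_penrose (gram J x) *v x i) = x i"
proof -
  let ?A = "gram J x" and ?G = "moore_penrose (gram J x)"
  have G: "?A ** ?G ** ?A = ?A" "transpose (?A ** ?G) = ?A ** ?G"
    using is_moore_penrose_moore_penrose[of ?A] by (simp_all add: is_moore_penrose_def)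
  let ?P = "?A ** ?G"
  define e where "e = x i - ?P *v x i"
  have AP: "?A ** ?P = ?A"
    by (metis G matrix_transpose_mul transpose_gram)
  have PP: "?P ** ?P = ?P"
    by (metis G(1) matrix_mul_assoc)
  have "?A *v e = 0"
    by (simp add: e_def matrix_vector_mult_diff_distrib matrix_vector_mul_assoc AP)
  then have "(\<Sum>j\<in>J. (x j \<bullet> e)\<^sup>2) = 0"
    using inner_gram_mult[of e J x e] by (simp add: power2_eq_square)
  then have "x i \<bullet> e = 0"
    using assms by (simp add: sum_nonneg_eq_0_iff)
  moreover have "(?P *v x i) \<bullet> e = 0"
    by (simp add: inner_symmetric_matrix[OF G(2)] e_def matrix_vector_mult_diff_distrib matrix_vector_mul_assoc PP)
  ultimately have "e \<bullet> e = 0"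
    by (subst (1) e_def) (simp add: inner_diff_left)
  then show ?thesis by (simp add: e_def matrix_vector_mul_assoc)
qed

section \<open>Leverages\<close>

text \<open>For \<open>i\<close> in \<open>J\<close> this is a diagonal entry of the hat matrix,
  which maps the responses to the fitted values.\<close>

definition leverage :: "'i set \<Rightarrow> ('i \<Rightarrow> real^'d) \<Rightarrow> 'i \<Rightarrow> real" where
  "leverage J x i = x i \<bullet> (moore_penrose (gram J x) *v x i)"

text \<open>The leverage h is a sum of squares over the sample, and the term of observation
  \<open>i\<close> in this sum is h^2. Hence h^2 \<le> h.\<close>

lemma leverage_bounds:
  assumes "finite J" "i \<in> J"
  shows "0 \<le> leverage J x i" "leverage J x i \<le> 1"
proof -
  let ?v = "moore_penrose (gram J x) *v x i"
  have h: "leverage J x i = (\<Sum>j\<in>J. (x j \<bullet> ?v)\<^sup>2)"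
    using inner_gram_mult[of ?v J x ?v] gram_moore_penrose_mult[OF assms, of x]
    by (simp add: leverage_def power2_eq_square inner_commute)
  then show "0 \<le> leverage J x i"
    by (simp add: sum_nonneg)
  \<comment> \<open>The factor 1 singles out the right-hand occurrence as the one to be expanded
    into the sum of squares.\<close>
  have "(leverage J x i)\<^sup>2 \<le> leverage J x i * 1"
    unfolding h[THEN trans[OF mult_1_right]] using assms
    by (auto simp: leverage_def intro!: member_le_sum[where f="\<lambda>j. (x j \<bullet> ?v)\<^sup>2"])
  then show "leverage J x i \<le> 1"
    using \<open>0 \<le> leverage J x i\<close> by (cases "leverage J x i = 0") (auto simp: power2_eq_square mult_le_cancel_left)
qed

text \<open>A diagonal entry p of a symmetric idempotent matrix is the sum of the squares of its
  row, so p^2 \<le> p and p \<le> 1. This bounds the trace without identifying it with the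
  rank.\<close>

lemma trace_projection_le:
  fixes P :: "real^'n^'n"
  assumes "transpose P = P" "P ** P = P"
  shows "trace P \<le> real CARD('n)"
proof -
  have "P $ k $ k \<le> 1" for k
  proof -
    have "P $ k $ k = (P ** P) $ k $ k"
      by (simp add: assms(2))
    also have "\<dots> = (\<Sum>l\<in>UNIV. P $ k $ l * P $ l $ k)"
      by (simp add: matrix_matrix_mult_def)
    also have "\<dots> = (\<Sum>l\<in>UNIV. (P $ k $ l)\<^sup>2)"
      by (subst (2) assms(1)[symmetric]) (simp add: transpose_def power2_eq_square)
    also have "\<dots> \<ge> (P $ k $ k)\<^sup>2"
      by (rule member_le_sum) auto
    finally have *: "(P $ k $ k)\<^sup>2 \<le> P $ k $ k" .
    then show ?thesis
      using power2_le_imp_le[of 1 "P $ k $ k"] by (cases "P $ k $ k > 1") (auto simp: power2_eq_square)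
  qed
  then have "trace P \<le> (\<Sum>k\<in>(UNIV::'n set). 1)"
    unfolding trace_def by (intro sum_mono) auto
  then show ?thesis by simp
qed

text \<open>Interchanging the sums turns the total leverage into the trace of
  \<open>?G ** ?A\<close>, which is a symmetric idempotent matrix.\<close>

lemma sum_leverage_le:
  fixes x :: "'i \<Rightarrow> real^'d"
  shows "(\<Sum>i\<in>J. leverage J x i) \<le> real CARD('d)"
proof -
  let ?A = "gram J x" and ?G = "moore_penrose (gram J x)"
  have G: "?G ** ?A ** ?G = ?G" "transpose (?G ** ?A) = ?G ** ?A"
    using is_moore_penrose_moore_penrose[of ?A] by (simp_all add: is_moore_penrose_def)
  have "(\<Sum>i\<in>J. leverage J x i) = (\<Sum>i\<in>J. \<Sum>k\<in>UNIV. \<Sum>l\<in>UNIV. x i $ k * (?G $ k $ l * x i $ l))"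
    by (simp add: leverage_def inner_vec_def matrix_vector_mult_def sum_distrib_left)
  also have "\<dots> = (\<Sum>k\<in>UNIV. \<Sum>l\<in>UNIV. ?G $ k $ l * ?A $ l $ k)"
    by (simp add: gram_nth sum_distrib_left sum.swap[of _ _ J] mult_ac)
  also have "\<dots> = trace (?G ** ?A)"
    by (simp add: trace_def matrix_matrix_mult_def)
  also have "\<dots> \<le> real CARD('d)"
    by (rule trace_projection_le) (use G in \<open>simp_all add: matrix_mul_assoc\<close>)
  finally show ?thesis .
qed

section \<open>Least squares and leave-one-out residuals\<close>

text \<open>Indexed by a set, so that deleting an observation or relabelling the sample only changes
  the index set.\<close>

definition ls_coeff :: "'i set \<Rightarrow> ('i \<Rightarrow> real^'d) \<Rightarrow> ('i \<Rightarrow> real) \<Rightarrow> real^'d" where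
  "ls_coeff J x y = moore_penrose (gram J x) *v (\<Sum>j\<in>J. y j *\<^sub>R x j)"

lemma erm_coeff_eq_ls_coeff: "erm_coeff n x y = ls_coeff {1..n} x y"
  by (simp add: erm_coeff_def ls_coeff_def gram_def)

text \<open>Solvable even for a singular Gram matrix, because the right-hand side is a combination
  of the \<open>x j\<close>, all of which lie in its range.\<close>

lemma normal_equations:
  assumes "finite J"
  shows "gram J x *v ls_coeff J x y = (\<Sum>j\<in>J. y j *\<^sub>R x j)"
proof -
  have "gram J x *v ls_coeff J x y
      = (\<Sum>j\<in>J. y j *\<^sub>R (gram J x *v (moore_penrose (gram J x) *v x j)))"
    by (simp add: ls_coeff_def linear_sum[OF matrix_vector_mul_linear] matrix_vector_mult_scaleR)
  also have "\<dots> = (\<Sum>j\<in>J. y j *\<^sub>R x j)"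
    using assms by (simp add: gram_moore_penrose_mult)
  finally show ?thesis .
qed

text \<open>Pythagoras: by the normal equations the residual vector is orthogonal to the change of
  fitted values \<open>x j \<bullet> u\<close>, so the cross term vanishes.\<close>

lemma ls_coeff_optimal:
  assumes "finite J"
  shows "(\<Sum>j\<in>J. (ls_coeff J x y \<bullet> x j - y j)\<^sup>2) \<le> (\<Sum>j\<in>J. (w \<bullet> x j - y j)\<^sup>2)"
proof -
  let ?w = "ls_coeff J x y"
  define u where "u = w - ?w"
  have "(\<Sum>j\<in>J. (x j \<bullet> u) * (x j \<bullet> ?w)) = (\<Sum>j\<in>J. (x j \<bullet> u) * y j)"
    using inner_gram_mult[of u J x ?w]
    by (simp add: normal_equations[OF assms] inner_sum_right inner_commute mult.commute)
  then have "(\<Sum>j\<in>J. (x j \<bullet> u) * (?w \<bullet> x j - y j)) = 0"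
    by (simp add: right_diff_distrib sum_subtractf inner_commute)
  moreover have "(w \<bullet> x j - y j)\<^sup>2 = (?w \<bullet> x j - y j)\<^sup>2 + 2 * ((x j \<bullet> u) * (?w \<bullet> x j - y j)) + (x j \<bullet> u)\<^sup>2" for j
    by (simp add: u_def inner_diff_right inner_commute power2_eq_square algebra_simps)
  ultimately have "(\<Sum>j\<in>J. (w \<bullet> x j - y j)\<^sup>2)
      = (\<Sum>j\<in>J. (?w \<bullet> x j - y j)\<^sup>2) + (\<Sum>j\<in>J. (x j \<bullet> u)\<^sup>2)"
    by (simp add: sum.distrib sum_distrib_left[symmetric])
  then show ?thesis by (simp add: sum_nonneg)
qed

text \<open>Subtract the normal equations of the two samples and pair the result with a preimage
  of \<open>x i\<close> under the full Gram matrix; no invertibility is needed.\<close>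

lemma leave_one_out_residual:
  assumes "finite J" "i \<in> J"
  shows "ls_coeff J x y \<bullet> x i - y i = (1 - leverage J x i) * (ls_coeff (J - {i}) x y \<bullet> x i - y i)"
proof -
  let ?w = "ls_coeff J x y" and ?w' = "ls_coeff (J - {i}) x y"
  let ?v = "moore_penrose (gram J x) *v x i"
  have fin: "finite (J - {i})" "i \<notin> J - {i}" and J: "J = insert i (J - {i})"
    using assms by auto
  have "gram J x *v ?w = (\<Sum>j\<in>J. y j *\<^sub>R x j)"
    by (rule normal_equations[OF assms(1)])
  also have "\<dots> = y i *\<^sub>R x i + gram (J - {i}) x *v ?w'"
    using assms by (simp add: normal_equations sum.remove[of J i])
  also have "\<dots> = y i *\<^sub>R x i + (gram J x *v ?w' - (x i \<bullet> ?w') *\<^sub>R x i)"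
    using gram_insert[OF fin, of x ?w'] J by simp
  finally have "gram J x *v (?w - ?w') = (y i - x i \<bullet> ?w') *\<^sub>R x i"
    by (simp add: matrix_vector_mult_diff_distrib scaleR_left_diff_distrib)
  then have "?v \<bullet> (gram J x *v (?w - ?w')) = (y i - x i \<bullet> ?w') * leverage J x i"
    by (simp add: leverage_def inner_commute)
  moreover have "?v \<bullet> (gram J x *v (?w - ?w')) = x i \<bullet> (?w - ?w')"
    by (simp add: inner_symmetric_matrix[symmetric] gram_moore_penrose_mult[OF assms])
  ultimately show ?thesis
    by (simp add: inner_diff_right inner_commute algebra_simps)
qed

lemma gram_reindex:
  assumes "inj_on p J"
  shows "gram J (\<lambda>j. x (p j)) = gram (p ` J) x"
  using assms by (simp add: gram_def sum.reindex)

lemma ls_coeff_reindex: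
  assumes "inj_on p J"
  shows "ls_coeff J (\<lambda>j. x (p j)) (\<lambda>j. y (p j)) = ls_coeff (p ` J) x y"
  using assms by (simp add: ls_coeff_def gram_reindex sum.reindex)

lemma ls_coeff_cong:
  assumes "\<And>j. j \<in> J \<Longrightarrow> x j = x' j" "\<And>j. j \<in> J \<Longrightarrow> y j = y' j"
  shows "ls_coeff J x y = ls_coeff J x' y'"
proof -
  have "gram J x = gram J x'" using assms by (simp add: gram_def)
  then show ?thesis using assms by (simp add: ls_coeff_def)
qed

subsection \<open>Measurability of the least squares solution\<close>

text \<open>Measurability of the pseudoinverse comes from approximation by the ridge solutions
  \<open>(A + e I)\<inverse> b\<close>, which Cramer's rule expresses rationally in the entries.\<close>

definition cramer_solution :: "real^'n^'n \<Rightarrow> real^'n \<Rightarrow> real^'n" where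
  "cramer_solution A b = (\<chi> k. det (\<chi> i j. if j = k then b $ i else A $ i $ j) / det A)"

text \<open>The error \<open>d\<close> satisfies
  \<open>A *v (e *\<^sub>R t - d) = e *\<^sub>R d\<close>. Positivity of the quadratic form at
  \<open>e *\<^sub>R t - d\<close> then gives
  \<open>d \<bullet> d \<le> e * (t \<bullet> d)\<close>, and Cauchy-Schwarz finishes.\<close>

lemma ridge_approximation:
  fixes A :: "real^'n^'n"
  assumes psd: "\<And>u. 0 \<le> u \<bullet> (A *v u)" and e: "e > 0"
  shows "norm (A *v t - cramer_solution (A + e *\<^sub>R mat 1) (A *v (A *v t))) \<le> e * norm t"
proof -
  let ?C = "A + e *\<^sub>R mat 1" and ?b = "A *v (A *v t)"
  have C: "?C *v u = A *v u + e *\<^sub>R u" for u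
    by (simp add: matrix_vector_mult_add_rdistrib scaleR_matrix_vector_assoc[symmetric])
  have "u = 0" if "?C *v u = 0" for u
  proof -
    have "u \<bullet> (A *v u) + e * (u \<bullet> u) = 0"
      using that by (metis C inner_add_right inner_scaleR_right inner_zero_right)
    then have "e * (u \<bullet> u) \<le> 0" using psd[of u] by linarith
    then have "u \<bullet> u \<le> 0" using e by (simp add: mult_le_0_iff)
    then show ?thesis by (metis antisym inner_eq_zero_iff inner_ge_zero)
  qed
  then have "invertible ?C"
    by (metis invertible_left_inverse matrix_left_invertible_ker)
  then have "det ?C \<noteq> 0" by (simp add: invertible_det_nz)
  then have z: "?C *v cramer_solution ?C ?b = ?b"
    by (simp add: cramer[of ?C _ ?b] cramer_solution_def)
  define d where "d = A *v t - cramer_solution ?C ?b"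
  have "?C *v d = e *\<^sub>R (A *v t)"
    by (simp add: d_def matrix_vector_mult_diff_distrib z) (simp add: C)
  then have "A *v d + e *\<^sub>R d = e *\<^sub>R (A *v t)"
    by (simp only: C)
  then have "A *v (e *\<^sub>R t - d) = e *\<^sub>R d"
    by (simp add: matrix_vector_mult_diff_distrib matrix_vector_mult_scaleR algebra_simps)
  then have "0 \<le> e * ((e *\<^sub>R t - d) \<bullet> d)"
    using psd[of "e *\<^sub>R t - d"] by simp
  then have "d \<bullet> d \<le> e * (t \<bullet> d)"
    using e by (simp add: zero_le_mult_iff inner_diff_left)
  also have "\<dots> \<le> e * (norm t * norm d)"
    using e norm_cauchy_schwarz[of t d] by simp
  finally have "norm d * norm d \<le> (e * norm t) * norm d"
    by (simp add: power2_norm_eq_inner[symmetric] power2_eq_square mult.assoc)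
  then have "norm d \<le> e * norm t"
    using e by (cases "d = 0") (auto simp: mult_le_cancel_right)
  then show ?thesis by (simp add: d_def)
qed

text \<open>The pseudoinverse solution lies in the range of \<open>A\<close>, say it is
  \<open>A *v t\<close>. As \<open>b\<close> is in the range too, \<open>b = A *v (A *v t)\<close>,
  which is the form treated by \<open>ridge_approximation\<close>, with an error of at most
  \<open>norm t\<close> divided by \<open>Suc k\<close>.\<close>

lemma ridge_tendsto:
  fixes A :: "real^'n^'n"
  assumes sym: "transpose A = A" and psd: "\<And>u. 0 \<le> u \<bullet> (A *v u)" and b: "b \<in> range ((*v) A)"
  shows "(\<lambda>k. cramer_solution (A + inverse (real (Suc k)) *\<^sub>R mat 1) b) \<longlonglongrightarrow> moore_penrose A *v b"
proof -
  obtain t where t: "moore_penrose A *v b = A *v t"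
    using moore_penrose_in_range[OF sym, of b] by blast
  obtain u where u: "b = A *v u" using b by blast
  have "A ** moore_penrose A ** A = A"
    using is_moore_penrose_moore_penrose[OF sym] by (simp add: is_moore_penrose_def)
  then have "A *v (moore_penrose A *v b) = b"
    by (simp add: u matrix_vector_mul_assoc matrix_mul_assoc)
  then have b': "b = A *v (A *v t)" by (simp add: t)
  have "(\<lambda>k. inverse (real (Suc k)) * norm t) \<longlonglongrightarrow> 0 * norm t"
    by (intro tendsto_mult LIMSEQ_inverse_real_of_nat tendsto_const)
  then have lim: "(\<lambda>k. inverse (real (Suc k)) * norm t) \<longlonglongrightarrow> 0"
    by (simp only: mult_zero_left)
  have "norm (cramer_solution (A + inverse (real (Suc k)) *\<^sub>R mat 1) b - A *v t)
      \<le> inverse (real (Suc k)) * norm t" for k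
    using ridge_approximation[OF psd, of "inverse (real (Suc k))" t]
    unfolding b'[symmetric] by (subst norm_minus_commute) simp
  then have "(\<lambda>k. cramer_solution (A + inverse (real (Suc k)) *\<^sub>R mat 1) b - A *v t) \<longlonglongrightarrow> 0"
    by (intro Lim_null_comparison[OF always_eventually lim] allI)
  then have "(\<lambda>k. cramer_solution (A + inverse (real (Suc k)) *\<^sub>R mat 1) b) \<longlonglongrightarrow> A *v t"
    by (rule LIM_zero_cancel)
  then show ?thesis by (simp add: t)
qed

section \<open>Borel measurability of ridge solutions, leverages and coefficients\<close>

lemma borel_measurable_vec_iff:
  fixes f :: "'w \<Rightarrow> real^'n"
  shows "f \<in> borel_measurable N \<longleftrightarrow> (\<forall>i. (\<lambda>\<omega>. f \<omega> $ i) \<in> borel_measurable N)"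
  by (subst borel_measurable_euclidean_space)
    (auto simp: Basis_vec_def cart_eq_inner_axis)

lemma borel_measurable_det:
  fixes A :: "'w \<Rightarrow> real^'n^'n"
  assumes [measurable]: "\<And>i j. (\<lambda>\<omega>. A \<omega> $ i $ j) \<in> borel_measurable N"
  shows "(\<lambda>\<omega>. det (A \<omega>)) \<in> borel_measurable N"
  unfolding det_def by measurable

lemma borel_measurable_cramer_solution:
  fixes A :: "'w \<Rightarrow> real^'n^'n"
  assumes [measurable]: "\<And>i j. (\<lambda>\<omega>. A \<omega> $ i $ j) \<in> borel_measurable N"
    and b: "b \<in> borel_measurable N"
  shows "(\<lambda>\<omega>. cramer_solution (A \<omega>) (b \<omega>)) \<in> borel_measurable N"
proof -
  have [measurable]: "(\<lambda>\<omega>. b \<omega> $ i) \<in> borel_measurable N" for i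
    using b borel_measurable_vec_iff by blast
  have "(\<lambda>\<omega>. det (\<chi> i j. if j = k then b \<omega> $ i else A \<omega> $ i $ j)) \<in> borel_measurable N" for k
    by (rule borel_measurable_det) simp
  moreover have "(\<lambda>\<omega>. det (A \<omega>)) \<in> borel_measurable N"
    by (rule borel_measurable_det) simp
  ultimately show ?thesis
    by (simp add: borel_measurable_vec_iff cramer_solution_def)
qed

text \<open>A pointwise limit of measurable ridge solutions. The range condition on \<open>b\<close>
  secures convergence: a component of \<open>b\<close> in the kernel of the Gram matrix would be
  divided by the vanishing ridge parameter.\<close>

lemma borel_measurable_moore_penrose_gram:
  fixes x :: "'w \<Rightarrow> 'i \<Rightarrow> real^'d"
  assumes x: "\<And>j. j \<in> J \<Longrightarrow> (\<lambda>\<omega>. x \<omega> j) \<in> borel_measurable N"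
    and b: "b \<in> borel_measurable N" "\<And>\<omega>. b \<omega> \<in> range ((*v) (gram J (x \<omega>)))"
  shows "(\<lambda>\<omega>. moore_penrose (gram J (x \<omega>)) *v b \<omega>) \<in> borel_measurable N"
proof (rule borel_measurable_LIMSEQ_metric)
  fix k
  have "(\<lambda>\<omega>. x \<omega> j $ i) \<in> borel_measurable N" if "j \<in> J" for i j
    using x[OF that] by (simp add: borel_measurable_vec_iff)
  then show "(\<lambda>\<omega>. cramer_solution (gram J (x \<omega>) + inverse (real (Suc k)) *\<^sub>R mat 1) (b \<omega>)) \<in> borel_measurable N"
    by (intro borel_measurable_cramer_solution b(1))
      (auto simp: gram_nth intro!: borel_measurable_add borel_measurable_sum borel_measurable_times)
next
  fix \<omega>
  have "0 \<le> u \<bullet> (gram J (x \<omega>) *v u)" for u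
    unfolding inner_gram_mult by (simp add: sum_nonneg)
  then show "(\<lambda>k. cramer_solution (gram J (x \<omega>) + inverse (real (Suc k)) *\<^sub>R mat 1) (b \<omega>))
      \<longlonglongrightarrow> moore_penrose (gram J (x \<omega>)) *v b \<omega>"
    by (intro ridge_tendsto b(2)) auto
qed

lemma borel_measurable_leverage:
  assumes "finite J" "i \<in> J" and x: "\<And>j. j \<in> J \<Longrightarrow> (\<lambda>\<omega>. x \<omega> j) \<in> borel_measurable N"
  shows "(\<lambda>\<omega>. leverage J (x \<omega>) i) \<in> borel_measurable N"
  unfolding leverage_def
  by (intro borel_measurable_inner borel_measurable_moore_penrose_gram x assms
      range_eqI[where f="(*v) _", OF gram_moore_penrose_mult[symmetric]])

lemma borel_measurable_ls_coeff:
  assumes "finite J" and x: "\<And>j. j \<in> J \<Longrightarrow> (\<lambda>\<omega>. x \<omega> j) \<in> borel_measurable N"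
    and y: "\<And>j. j \<in> J \<Longrightarrow> (\<lambda>\<omega>. y \<omega> j) \<in> borel_measurable N"
  shows "(\<lambda>\<omega>. ls_coeff J (x \<omega>) (y \<omega>)) \<in> borel_measurable N"
  unfolding ls_coeff_def
  by (intro borel_measurable_moore_penrose_gram borel_measurable_sum borel_measurable_scaleR x y)
    (auto simp: normal_equations[OF assms(1), symmetric])

subsection \<open>Truncation under a bounded conditional second moment\<close>

definition clip :: "real \<Rightarrow> real \<Rightarrow> real" where
  "clip m t = max (- m) (min m t)"

lemma truncated_ls_eq_clip: "truncated_ls m n x y z = clip m (ls_coeff {1..n} x y \<bullet> z)"
  by (simp add: truncated_ls_def clip_def erm_coeff_eq_ls_coeff)

lemma borel_measurable_clip [measurable]: "clip m \<in> borel_measurable borel"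
  unfolding clip_def by measurable

lemma sq_diff_le: "(a - b)\<^sup>2 \<le> 2 * a\<^sup>2 + 2 * (b::real)\<^sup>2"
  using zero_le_power2[of "a + b"] by (simp add: power2_eq_square algebra_simps)

text \<open>Clipping can increase the error only when \<open>\<bar>y\<bar> > m\<close>, and the loss is then controlled
  by \<open>y\<^sup>2 - m\<^sup>2\<close>, whose conditional expectation is nonpositive.\<close>

lemma clip_error_le:
  assumes "m > 0"
  shows "(clip m t - y)\<^sup>2 + max 0 (\<bar>t\<bar> - m) * m \<le> (t - y)\<^sup>2 + max 0 (\<bar>t\<bar> - m) / m * y\<^sup>2"
proof -
  have key: "(m - y)\<^sup>2 + (t - m) * m \<le> (t - y)\<^sup>2 + (t - m) / m * y\<^sup>2" if "t > m" for t y
  proof -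
    \<comment> \<open>The tangent to the square at \<open>m\<close> trades the term linear in
      \<open>y\<close> for y^2 / m, whose conditional mean is at most \<open>m\<close>.\<close>
    have "m\<^sup>2 + 2 * m * (y - m) \<le> y\<^sup>2"
      using zero_le_power2[of "y - m"] by (simp add: power2_eq_square algebra_simps)
    then have "m + 2 * (y - m) \<le> y\<^sup>2 / m"
      using assms by (simp add: field_simps power2_eq_square)
    then have "(t - m) * (m + 2 * (y - m)) \<le> (t - m) * (y\<^sup>2 / m)"
      using that by (intro mult_left_mono) auto
    moreover have "(m - y)\<^sup>2 - (t - y)\<^sup>2 = 2 * (t - m) * (y - m) - (t - m)\<^sup>2"
      by (simp add: power2_eq_square algebra_simps)
    moreover have "(t - m) * (m + 2 * (y - m)) = (t - m) * m + 2 * (t - m) * (y - m)"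
      by (simp add: algebra_simps)
    moreover have "(t - m) / m * y\<^sup>2 = (t - m) * (y\<^sup>2 / m)"
      by simp
    ultimately show ?thesis
      using zero_le_power2[of "t - m"] by linarith
  qed
  consider "\<bar>t\<bar> \<le> m" | "t > m" | "- t > m" by linarith
  then show ?thesis
  proof cases
    case 1
    then show ?thesis by (simp add: clip_def)
  next
    case 2
    then have "clip m t = m" "max 0 (\<bar>t\<bar> - m) = t - m" using assms by (auto simp: clip_def)
    then show ?thesis using key[OF 2, of y] by simp
  next
    case 3
    then have "clip m t = - m" "max 0 (\<bar>t\<bar> - m) = - t - m" using assms by (auto simp: clip_def)
    moreover have "(- m - y)\<^sup>2 = (m - (- y))\<^sup>2" "(t - y)\<^sup>2 = (- t - (- y))\<^sup>2"
      by (simp_all add: power2_eq_square algebra_simps)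
    ultimately show ?thesis using key[OF 3, of "- y"] by simp
  qed
qed

text \<open>Scale \<open>clip_error_le\<close> by (1 - h)^2. The remaining fraction of the clipped
  loss is at most 2 h, and the clipped loss is at most 2 m^2 + 2 y^2; this produces the two terms
  with factor 4 h.\<close>

lemma clip_error_shrunk_le:
  fixes m h t y :: real
  assumes "m > 0" "0 \<le> h" "h \<le> 1"
  defines "k \<equiv> (1 - h)\<^sup>2 * max 0 (\<bar>t\<bar> - m)"
  shows "(clip m t - y)\<^sup>2 + m * k \<le> ((1 - h) * (t - y))\<^sup>2 + 4 * m\<^sup>2 * h + (k / m + 4 * h) * y\<^sup>2"
proof -
  have "(1 - h)\<^sup>2 * ((clip m t - y)\<^sup>2 + max 0 (\<bar>t\<bar> - m) * m)
      \<le> (1 - h)\<^sup>2 * ((t - y)\<^sup>2 + max 0 (\<bar>t\<bar> - m) / m * y\<^sup>2)"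
    by (intro mult_left_mono clip_error_le assms) simp
  then have 1: "(1 - h)\<^sup>2 * (clip m t - y)\<^sup>2 + m * k \<le> ((1 - h) * (t - y))\<^sup>2 + k / m * y\<^sup>2"
    by (simp add: k_def power_mult_distrib distrib_left mult_ac)
  have "\<bar>clip m t\<bar> \<le> m" using assms(1) by (auto simp: clip_def)
  then have "(clip m t)\<^sup>2 \<le> m\<^sup>2" by (simp add: abs_le_square_iff[symmetric])
  then have "(clip m t - y)\<^sup>2 \<le> 2 * m\<^sup>2 + 2 * y\<^sup>2"
    using sq_diff_le[of "clip m t" y] by linarith
  then have "(1 - (1 - h)\<^sup>2) * (clip m t - y)\<^sup>2 \<le> (2 * h) * (2 * m\<^sup>2 + 2 * y\<^sup>2)"
    using assms
  proof (intro mult_mono)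
    show "1 - (1 - h)\<^sup>2 \<le> 2 * h" by (simp add: power2_eq_square algebra_simps)
  qed auto
  then show ?thesis using 1 by (simp add: algebra_simps)
qed

lemma borel_measurable_fst_snd [measurable]:
  "fst \<in> borel_measurable (borel :: ('a::topological_space \<times> 'b::topological_space) measure)"
  "snd \<in> borel_measurable (borel :: ('a \<times> 'b) measure)"
  by (auto intro!: borel_measurable_continuous_onI continuous_intros)

section \<open>Laws with bounded conditional second moment\<close>

text \<open>The conditional moment bound in weak form, tested against nonnegative weights
  \<open>k\<close> of the covariate, so that later arguments involve only the law \<open>D\<close>
  and no conditional expectations.\<close>

locale bounded_second_moment = prob_space D
  for D :: "((real^'d::finite) \<times> real) measure" +
  fixes m :: real
  assumes sets_D [measurable_cong]: "sets D = sets borel"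
    and m_pos: "m > 0"
    and conditional_moment: "k \<in> borel_measurable borel \<Longrightarrow>
      (\<integral>\<^sup>+z. k (fst z) * ennreal ((snd z)\<^sup>2) \<partial>D) \<le> ennreal (m\<^sup>2) * (\<integral>\<^sup>+z. k (fst z) \<partial>D)"
begin

lemma second_moment_le: "(\<integral>\<^sup>+z. ennreal ((snd z)\<^sup>2) \<partial>D) \<le> ennreal (m\<^sup>2)"
  using conditional_moment[of "\<lambda>_. 1"] by (simp add: emeasure_space_1)

text \<open>Integrate \<open>clip_error_shrunk_le\<close>. The weight of y^2 there depends on the
  covariate alone, so y^2 may be replaced by m^2; this reproduces the term \<open>m * k\<close> of
  the left side and adds a second 4 m^2 h to the first, whence the 8. Cancelling
  \<open>m * k\<close> needs its integral to be finite.\<close>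

lemma clip_risk_le:
  fixes g h :: "real^'d \<Rightarrow> real"
  assumes [measurable]: "g \<in> borel_measurable borel" "h \<in> borel_measurable borel"
    and h: "\<And>x. 0 \<le> h x" "\<And>x. h x \<le> 1"
  shows "(\<integral>\<^sup>+z. ennreal ((clip m (g (fst z)) - snd z)\<^sup>2) \<partial>D)
    \<le> (\<integral>\<^sup>+z. ennreal (((1 - h (fst z)) * (g (fst z) - snd z))\<^sup>2) \<partial>D)
      + ennreal (8 * m\<^sup>2) * (\<integral>\<^sup>+z. ennreal (h (fst z)) \<partial>D)"
    (is "?L \<le> ?R + _ * ?H")
proof (cases "?R = \<top>")
  case False
  define k where "k x = (1 - h x)\<^sup>2 * max 0 (\<bar>g x\<bar> - m)" for x
  have k_nonneg: "0 \<le> k x" for x by (simp add: k_def)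
  have [measurable]: "k \<in> borel_measurable borel" unfolding k_def by measurable
  let ?K = "\<integral>\<^sup>+z. ennreal (k (fst z)) \<partial>D"
  \<comment> \<open>An integrable majorant of \<open>k\<close>, as \<open>?R\<close> is finite in
    this case and the second moment of the response is at most m^2.\<close>
  have "k (fst z) \<le> 1 + (((1 - h (fst z)) * (g (fst z) - snd z))\<^sup>2 + (snd z)\<^sup>2)" for z
  proof -
    let ?c = "(1 - h (fst z))\<^sup>2" and ?t = "g (fst z)" and ?y = "snd z"
    have c: "0 \<le> ?c" "?c \<le> 1" using h[of "fst z"] by (auto simp: power_le_one_iff)
    have le: "\<bar>a\<bar> \<le> a\<^sup>2 / 2 + 1 / 2" for a :: real
      using zero_le_power2[of "\<bar>a\<bar> - 1"] by (simp add: power2_eq_square algebra_simps abs_mult_self_eq)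
    have "k (fst z) \<le> ?c * \<bar>?t\<bar>"
      unfolding k_def using m_pos by (intro mult_left_mono) auto
    also have "\<dots> \<le> ?c * ((?t - ?y)\<^sup>2 + (?y\<^sup>2 + 1))"
    proof (rule mult_left_mono)
      show "\<bar>?t\<bar> \<le> (?t - ?y)\<^sup>2 + (?y\<^sup>2 + 1)"
        using le[of "?t - ?y"] le[of ?y] abs_triangle_ineq[of "?t - ?y" ?y]
          zero_le_power2[of "?t - ?y"] zero_le_power2[of ?y] by linarith
    qed (rule c)
    also have "\<dots> \<le> ?c * (?t - ?y)\<^sup>2 + 1 * (?y\<^sup>2 + 1)"
      unfolding distrib_left using c by (intro add_left_mono add_mono mult_right_mono) auto
    finally show ?thesis by (simp add: power_mult_distrib)
  qed
  then have "?K \<le> (\<integral>\<^sup>+z. 1 + (ennreal (((1 - h (fst z)) * (g (fst z) - snd z))\<^sup>2) + ennreal ((snd z)\<^sup>2)) \<partial>D)"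
    by (intro nn_integral_mono) (simp flip: ennreal_plus ennreal_1)
  also have "\<dots> = 1 + (?R + (\<integral>\<^sup>+z. ennreal ((snd z)\<^sup>2) \<partial>D))"
    by (simp add: nn_integral_add emeasure_space_1)
  also have "\<dots> < \<top>"
    using False second_moment_le by (auto simp: less_top[symmetric] top_unique)
  finally have K_fin: "ennreal m * ?K \<noteq> \<top>"
    by (auto simp: ennreal_mult_eq_top_iff)
  have "?L + ennreal m * ?K
      = (\<integral>\<^sup>+z. ennreal ((clip m (g (fst z)) - snd z)\<^sup>2 + m * k (fst z)) \<partial>D)"
    using m_pos k_nonneg by (simp add: nn_integral_add nn_integral_cmult ennreal_mult)
  also have "\<dots> \<le> (\<integral>\<^sup>+z. ennreal (((1 - h (fst z)) * (g (fst z) - snd z))\<^sup>2 + 4 * m\<^sup>2 * h (fst z)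
      + (k (fst z) / m + 4 * h (fst z)) * (snd z)\<^sup>2) \<partial>D)"
    unfolding k_def by (intro nn_integral_mono ennreal_leI clip_error_shrunk_le m_pos h)
  also have "\<dots> = (\<integral>\<^sup>+z. ennreal (((1 - h (fst z)) * (g (fst z) - snd z))\<^sup>2)
      + ennreal (4 * m\<^sup>2) * ennreal (h (fst z))
      + ennreal (k (fst z) / m + 4 * h (fst z)) * ennreal ((snd z)\<^sup>2) \<partial>D)"
  proof (intro nn_integral_cong)
    fix z :: "(real^'d) \<times> real"
    have "0 \<le> k (fst z) / m + 4 * h (fst z)" using m_pos k_nonneg h by simp
    then show "ennreal (((1 - h (fst z)) * (g (fst z) - snd z))\<^sup>2 + 4 * m\<^sup>2 * h (fst z)
        + (k (fst z) / m + 4 * h (fst z)) * (snd z)\<^sup>2)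
      = ennreal (((1 - h (fst z)) * (g (fst z) - snd z))\<^sup>2) + ennreal (4 * m\<^sup>2) * ennreal (h (fst z))
        + ennreal (k (fst z) / m + 4 * h (fst z)) * ennreal ((snd z)\<^sup>2)"
      using h by (subst ennreal_plus ennreal_mult; simp)+
  qed
  also have "\<dots> = ?R + ennreal (4 * m\<^sup>2) * ?H
      + (\<integral>\<^sup>+z. ennreal (k (fst z) / m + 4 * h (fst z)) * ennreal ((snd z)\<^sup>2) \<partial>D)"
    by (simp add: nn_integral_add nn_integral_cmult)
  also have "\<dots> \<le> ?R + ennreal (4 * m\<^sup>2) * ?H
      + ennreal (m\<^sup>2) * (\<integral>\<^sup>+z. ennreal (k (fst z) / m + 4 * h (fst z)) \<partial>D)"
    using conditional_moment[of "\<lambda>x. ennreal (k x / m + 4 * h x)"] by (intro add_left_mono) simp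
  also have "ennreal (m\<^sup>2) * (\<integral>\<^sup>+z. ennreal (k (fst z) / m + 4 * h (fst z)) \<partial>D)
      = (\<integral>\<^sup>+z. ennreal (m * k (fst z) + 4 * m\<^sup>2 * h (fst z)) \<partial>D)"
  proof -
    have "m\<^sup>2 * (k x / m + 4 * h x) = m * k x + 4 * m\<^sup>2 * h x" for x
      using m_pos by (simp add: distrib_left power2_eq_square)
    then show ?thesis
      by (subst nn_integral_cmult[symmetric]) (simp_all flip: ennreal_mult')
  qed
  also have "\<dots> = ennreal m * ?K + ennreal (4 * m\<^sup>2) * ?H"
    using m_pos k_nonneg h by (simp add: nn_integral_add nn_integral_cmult ennreal_mult)
  finally have "ennreal m * ?K + ?L
      \<le> ennreal m * ?K + (?R + (ennreal (4 * m\<^sup>2) * ?H + ennreal (4 * m\<^sup>2) * ?H))"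
    by (simp add: add_ac)
  then have "?L \<le> ?R + (ennreal (4 * m\<^sup>2) * ?H + ennreal (4 * m\<^sup>2) * ?H)"
    using K_fin by (simp add: ennreal_add_left_cancel_le)
  also have "ennreal (4 * m\<^sup>2) * ?H + ennreal (4 * m\<^sup>2) * ?H = ennreal (8 * m\<^sup>2) * ?H"
    by (simp flip: distrib_right ennreal_plus)
  finally show ?thesis .
qed simp

end

text \<open>A weight \<open>k (X \<omega>)\<close> is measurable for the sigma-algebra of
  \<open>X\<close>, so under the integral Y^2 may be replaced by its conditional expectation, which
  is almost everywhere \<open>\<phi> (X \<omega>)\<close>.\<close>

lemma bounded_second_moment_distr:
  fixes X :: "'a \<Rightarrow> real^'d" and Y :: "'a \<Rightarrow> real"
  assumes "prob_space M" and X [measurable]: "X \<in> borel_measurable M"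
    and [measurable]: "Y \<in> borel_measurable M" and "m > 0"
    and \<phi>: "cond_exp_version M X (\<lambda>\<omega>. ennreal ((Y \<omega>)\<^sup>2)) \<phi>" "(SUP x. \<phi> x) \<le> ennreal (m\<^sup>2)"
  shows "bounded_second_moment (distr M borel (\<lambda>\<omega>. (X \<omega>, Y \<omega>))) m"
proof -
  interpret prob_space M by fact
  let ?F = "vimage_algebra (space M) X borel"
  have "finite_measure_subalgebra M ?F"
    using measurable_sets[OF X]
    by unfold_locales (auto simp: subalgebra_def sets_vimage_algebra2)
  then interpret finite_measure_subalgebra M ?F .
  have moment: "(\<integral>\<^sup>+\<omega>. k (X \<omega>) * ennreal ((Y \<omega>)\<^sup>2) \<partial>M) \<le> ennreal (m\<^sup>2) * (\<integral>\<^sup>+\<omega>. k (X \<omega>) \<partial>M)"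
    if k [measurable]: "k \<in> borel_measurable borel" for k :: "real^'d \<Rightarrow> ennreal"
  proof -
    have "(\<lambda>\<omega>. k (X \<omega>)) \<in> borel_measurable ?F"
      by (rule measurable_compose[OF measurable_vimage_algebra1 k]) simp
    then have "(\<integral>\<^sup>+\<omega>. k (X \<omega>) * ennreal ((Y \<omega>)\<^sup>2) \<partial>M)
        = (\<integral>\<^sup>+\<omega>. k (X \<omega>) * nn_cond_exp M ?F (\<lambda>\<omega>. ennreal ((Y \<omega>)\<^sup>2)) \<omega> \<partial>M)"
      by (intro nn_cond_exp_intg[symmetric]) auto
    also have "\<dots> \<le> (\<integral>\<^sup>+\<omega>. ennreal (m\<^sup>2) * k (X \<omega>) \<partial>M)"
    proof (rule nn_integral_mono_AE)
      have "AE \<omega> in M. nn_cond_exp M ?F (\<lambda>\<omega>. ennreal ((Y \<omega>)\<^sup>2)) \<omega> = \<phi> (X \<omega>)"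
        using \<phi>(1) by (simp add: cond_exp_version_def)
      then show "AE \<omega> in M. k (X \<omega>) * nn_cond_exp M ?F (\<lambda>\<omega>. ennreal ((Y \<omega>)\<^sup>2)) \<omega> \<le> ennreal (m\<^sup>2) * k (X \<omega>)"
      proof eventually_elim
        case (elim \<omega>)
        have "\<phi> (X \<omega>) \<le> ennreal (m\<^sup>2)" using \<phi>(2) by (simp add: SUP_le_iff)
        then show ?case unfolding elim by (subst mult.commute) (rule mult_right_mono, simp_all)
      qed
    qed
    also have "\<dots> = ennreal (m\<^sup>2) * (\<integral>\<^sup>+\<omega>. k (X \<omega>) \<partial>M)"
      by (simp add: nn_integral_cmult)
    finally show ?thesis .
  qed
  show ?thesis
  proof (intro bounded_second_moment.intro bounded_second_moment_axioms.intro)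
    show "prob_space (distr M borel (\<lambda>\<omega>. (X \<omega>, Y \<omega>)))"
      by (rule prob_space_distr) simp
  next
    fix k :: "real^'d \<Rightarrow> ennreal" assume k: "k \<in> borel_measurable borel"
    then show "(\<integral>\<^sup>+z. k (fst z) * ennreal ((snd z)\<^sup>2) \<partial>distr M borel (\<lambda>\<omega>. (X \<omega>, Y \<omega>)))
        \<le> ennreal (m\<^sup>2) * (\<integral>\<^sup>+z. k (fst z) \<partial>distr M borel (\<lambda>\<omega>. (X \<omega>, Y \<omega>)))"
      using moment[OF k] by (simp add: nn_integral_distr)
  qed (use \<open>m > 0\<close> in simp_all)
qed

subsection \<open>Leave-one-out errors of an independent sample\<close>

context bounded_second_moment
begin

lemma product_sigma_finite_sample: "product_sigma_finite (\<lambda>_. D)"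
  by unfold_locales

lemma prob_space_sample: "prob_space (PiM I (\<lambda>_. D))"
  by (intro prob_space_PiM prob_space_axioms)

lemma measurable_sample [measurable (raw)]:
  assumes "j \<in> I"
  shows "(\<lambda>z. z j) \<in> borel_measurable (PiM I (\<lambda>_. D))"
  using measurable_component_singleton[OF assms, of "\<lambda>_. D"] sets_D measurable_cong_sets by blast

lemma measurable_ls_coeff_sample:
  assumes "finite J" "J \<subseteq> I"
  shows "(\<lambda>z. ls_coeff J (\<lambda>j. fst (z j)) (\<lambda>j. snd (z j))) \<in> borel_measurable (PiM I (\<lambda>_. D))"
  by (rule borel_measurable_ls_coeff[OF assms(1)]) (use assms(2) in \<open>auto intro!: measurable_compose[OF measurable_sample]\<close>)

lemma measurable_leverage_sample:
  assumes "finite I" "i \<in> I"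
  shows "(\<lambda>z. leverage I (\<lambda>j. fst (z j)) i) \<in> borel_measurable (PiM I (\<lambda>_. D))"
  by (rule borel_measurable_leverage[OF assms]) measurable

text \<open>Observation \<open>i\<close> serves as test pair, the rest of \<open>I\<close> as
  training sample. Extended nonnegative values give every expectation a meaning without moment
  assumptions.\<close>

definition loo_loss :: "'i set \<Rightarrow> 'i \<Rightarrow> ('i \<Rightarrow> (real^'d) \<times> real) \<Rightarrow> ennreal" where
  "loo_loss I i z = ennreal ((clip m (ls_coeff (I - {i}) (\<lambda>j. fst (z j)) (\<lambda>j. snd (z j)) \<bullet> fst (z i)) - snd (z i))\<^sup>2)"

lemma measurable_loo_loss:
  assumes "finite I" "i \<in> I"
  shows "loo_loss I i \<in> borel_measurable (PiM I (\<lambda>_. D))"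
proof -
  note [simp] = assms(2)
  note [measurable (raw)] = measurable_ls_coeff_sample[OF finite_Diff[OF assms(1)] Diff_subset]
  show ?thesis unfolding loo_loss_def by measurable
qed

lemma loo_loss_fun_upd:
  assumes "i \<notin> J"
  shows "loo_loss (insert i J) i (r(i := z))
    = ennreal ((clip m (ls_coeff J (\<lambda>j. fst (r j)) (\<lambda>j. snd (r j)) \<bullet> fst z) - snd z)\<^sup>2)"
proof -
  have "ls_coeff J (\<lambda>j. fst ((r(i := z)) j)) (\<lambda>j. snd ((r(i := z)) j))
      = ls_coeff J (\<lambda>j. fst (r j)) (\<lambda>j. snd (r j))"
    using assms by (intro ls_coeff_cong) auto
  then show ?thesis using assms by (simp add: loo_loss_def)
qed

text \<open>By Tonelli, integrate over observation \<open>i\<close> first with the others frozen at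
  \<open>r\<close>. The leave-one-out coefficient is then constant and \<open>clip_risk_le\<close>
  applies; \<open>leave_one_out_residual\<close> turns the shrunken residual into the full-sample
  one.\<close>

lemma loo_loss_le:
  assumes "finite I" "i \<in> I"
  shows "(\<integral>\<^sup>+z. loo_loss I i z \<partial>PiM I (\<lambda>_. D))
    \<le> (\<integral>\<^sup>+z. ennreal ((ls_coeff I (\<lambda>j. fst (z j)) (\<lambda>j. snd (z j)) \<bullet> fst (z i) - snd (z i))\<^sup>2)
         + ennreal (8 * m\<^sup>2) * ennreal (leverage I (\<lambda>j. fst (z j)) i) \<partial>PiM I (\<lambda>_. D))"
    (is "_ \<le> (\<integral>\<^sup>+z. ?F z \<partial>_)")
proof -
  interpret product_sigma_finite "\<lambda>_. D" by (rule product_sigma_finite_sample)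
  define J where "J = I - {i}"
  have J: "finite J" "i \<notin> J" "I = insert i J" using assms by (auto simp: J_def)
  note [simp] = assms(2)
  note [measurable (raw)] = measurable_ls_coeff_sample[OF assms(1) order_refl]
    measurable_leverage_sample[OF assms]
  have F: "?F \<in> borel_measurable (PiM I (\<lambda>_. D))" by measurable
  have "(\<integral>\<^sup>+z. loo_loss I i z \<partial>PiM I (\<lambda>_. D)) = (\<integral>\<^sup>+r. (\<integral>\<^sup>+z. loo_loss I i (r(i := z)) \<partial>D) \<partial>PiM J (\<lambda>_. D))"
    using product_nn_integral_insert[OF J(1,2)] measurable_loo_loss[OF assms] by (simp add: J(3))
  also have "\<dots> \<le> (\<integral>\<^sup>+r. (\<integral>\<^sup>+z. ?F (r(i := z)) \<partial>D) \<partial>PiM J (\<lambda>_. D))"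
  proof (rule nn_integral_mono)
    fix r :: "'a \<Rightarrow> (real^'d) \<times> real"
    let ?w = "ls_coeff J (\<lambda>j. fst (r j)) (\<lambda>j. snd (r j))"
    \<comment> \<open>Leverages involve no responses, so with \<open>r\<close> frozen this one is a
      function of the covariate of observation \<open>i\<close> alone, as
      \<open>clip_risk_le\<close> demands.\<close>
    define h where "h x = leverage I (\<lambda>j. if j = i then x else fst (r j)) i" for x
    have h_eq: "leverage I (\<lambda>j. fst ((r(i := z)) j)) i = h (fst z)" for z
    proof -
      have "(\<lambda>j. fst ((r(i := z)) j)) = (\<lambda>j. if j = i then fst z else fst (r j))" by auto
      then show ?thesis by (simp add: h_def)
    qed
    have [measurable]: "h \<in> borel_measurable borel"
      unfolding h_def by (rule borel_measurable_leverage[OF assms]) simp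
    have h_bounds: "0 \<le> h x" "h x \<le> 1" for x
      by (simp_all add: h_def leverage_bounds[OF assms])
    have F_eq: "?F (r(i := z)) = ennreal (((1 - h (fst z)) * (?w \<bullet> fst z - snd z))\<^sup>2)
        + ennreal (8 * m\<^sup>2) * ennreal (h (fst z))" for z
    proof -
      have "ls_coeff J (\<lambda>j. fst ((r(i := z)) j)) (\<lambda>j. snd ((r(i := z)) j)) = ?w"
        using J(2) by (intro ls_coeff_cong) auto
      then show ?thesis
        using leave_one_out_residual[OF assms, of "\<lambda>j. fst ((r(i := z)) j)" "\<lambda>j. snd ((r(i := z)) j)"]
        unfolding h_eq J_def[symmetric] by simp
    qed
    have "(\<integral>\<^sup>+z. loo_loss I i (r(i := z)) \<partial>D) = (\<integral>\<^sup>+z. ennreal ((clip m (?w \<bullet> fst z) - snd z)\<^sup>2) \<partial>D)"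
      by (simp add: loo_loss_fun_upd[OF J(2)] J(3))
    also have "\<dots> \<le> (\<integral>\<^sup>+z. ennreal (((1 - h (fst z)) * (?w \<bullet> fst z - snd z))\<^sup>2) \<partial>D)
        + ennreal (8 * m\<^sup>2) * (\<integral>\<^sup>+z. ennreal (h (fst z)) \<partial>D)"
      by (rule clip_risk_le) (simp_all add: h_bounds)
    also have "\<dots> = (\<integral>\<^sup>+z. ?F (r(i := z)) \<partial>D)"
      unfolding F_eq by (simp add: nn_integral_add nn_integral_cmult)
    finally show "(\<integral>\<^sup>+z. loo_loss I i (r(i := z)) \<partial>D) \<le> (\<integral>\<^sup>+z. ?F (r(i := z)) \<partial>D)" .
  qed
  also have "\<dots> = (\<integral>\<^sup>+z. ?F z \<partial>PiM I (\<lambda>_. D))"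
    using product_nn_integral_insert[OF J(1,2), of ?F] F by (simp add: J(3))
  finally show ?thesis .
qed

text \<open>Swapping the coordinates \<open>i\<close> and \<open>j\<close> preserves the product
  law, and the least squares coefficient does not depend on how the training pairs are
  labelled.\<close>

lemma loo_loss_exchangeable:
  assumes "finite I" "i \<in> I" "j \<in> I"
  shows "(\<integral>\<^sup>+z. loo_loss I i z \<partial>PiM I (\<lambda>_. D)) = (\<integral>\<^sup>+z. loo_loss I j z \<partial>PiM I (\<lambda>_. D))"
proof -
  define p where "p = Transposition.transpose i j"
  have p: "inj_on p A" "p i = j" for A by (auto simp: p_def intro: inj_on_subset[OF inj_transpose])
  have p_in: "p k \<in> I" if "k \<in> I" for k
    using that assms by (auto simp: p_def Transposition.transpose_def)
  have p_img: "p ` (I - {i}) = I - {j}"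
  proof -
    have "p ` I = I" unfolding p_def using assms by (intro transpose_image_eq) auto
    then show ?thesis using p(2) by (simp add: image_set_diff[OF p(1)])
  qed
  define q where "q z = (\<lambda>n\<in>I. z (p n))" for z :: "'a \<Rightarrow> (real^'d) \<times> real"
  have q_meas: "q \<in> PiM I (\<lambda>_. D) \<rightarrow>\<^sub>M PiM I (\<lambda>_. D)"
    unfolding q_def by (intro measurable_restrict measurable_component_singleton p_in)
  have "distr (PiM I (\<lambda>_. D)) (PiM I (\<lambda>_. D)) q = PiM I (\<lambda>_. D)"
    using distr_PiM_reindex[of I "\<lambda>_. D" p I] p_in prob_space_axioms
    by (auto simp: q_def[abs_def] p(1))
  then have "(\<integral>\<^sup>+z. loo_loss I i z \<partial>PiM I (\<lambda>_. D)) = (\<integral>\<^sup>+z. loo_loss I i z \<partial>distr (PiM I (\<lambda>_. D)) (PiM I (\<lambda>_. D)) q)"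
    by simp
  also have "\<dots> = (\<integral>\<^sup>+z. loo_loss I i (q z) \<partial>PiM I (\<lambda>_. D))"
    by (rule nn_integral_distr[OF q_meas]) (use measurable_loo_loss assms in auto)
  also have "\<dots> = (\<integral>\<^sup>+z. loo_loss I j z \<partial>PiM I (\<lambda>_. D))"
  proof (rule nn_integral_cong)
    fix z :: "'a \<Rightarrow> (real^'d) \<times> real"
    have "ls_coeff (I - {i}) (\<lambda>k. fst (q z k)) (\<lambda>k. snd (q z k))
        = ls_coeff (I - {i}) (\<lambda>k. fst (z (p k))) (\<lambda>k. snd (z (p k)))"
      by (intro ls_coeff_cong) (auto simp: q_def)
    also have "\<dots> = ls_coeff (I - {j}) (\<lambda>k. fst (z k)) (\<lambda>k. snd (z k))"
      using ls_coeff_reindex[OF p(1), of "I - {i}" "\<lambda>k. fst (z k)" "\<lambda>k. snd (z k)"] by (simp add: p_img)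
    finally show "loo_loss I i (q z) = loo_loss I j z"
      using assms by (simp add: loo_loss_def q_def p(2))
  qed
  finally show ?thesis .
qed

text \<open>By exchangeability the left side is the sum of all leave-one-out errors. For each sample
  the fitted residuals are dominated in sum of squares by those of the competitor \<open>w\<close>,
  and the leverages add up to at most the dimension; each pair has law \<open>D\<close>.\<close>

lemma card_mult_loo_loss_le:
  assumes "finite I" "i \<in> I"
  shows "of_nat (card I) * (\<integral>\<^sup>+z. loo_loss I i z \<partial>PiM I (\<lambda>_. D))
    \<le> of_nat (card I) * (\<integral>\<^sup>+z. ennreal ((w \<bullet> fst z - snd z)\<^sup>2) \<partial>D) + ennreal (8 * m\<^sup>2 * real CARD('d))"
proof -
  let ?P = "PiM I (\<lambda>_. D)"
  let ?F = "\<lambda>i z. ennreal ((ls_coeff I (\<lambda>j. fst (z j)) (\<lambda>j. snd (z j)) \<bullet> fst (z i) - snd (z i))\<^sup>2)"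
  let ?H = "\<lambda>i z. ennreal (8 * m\<^sup>2) * ennreal (leverage I (\<lambda>j. fst (z j)) i)"
  interpret P: prob_space ?P by (rule prob_space_sample)
  note [measurable (raw)] = measurable_ls_coeff_sample[OF assms(1) order_refl] measurable_leverage_sample[OF assms(1)]
  have marginal: "(\<integral>\<^sup>+z. ennreal ((w \<bullet> fst (z k) - snd (z k))\<^sup>2) \<partial>?P)
      = (\<integral>\<^sup>+z. ennreal ((w \<bullet> fst z - snd z)\<^sup>2) \<partial>D)" if "k \<in> I" for k
  proof -
    have "distr ?P D (\<lambda>z. z k) = D"
      by (rule distr_PiM_component) (use that prob_space_axioms in auto)
    then have "(\<integral>\<^sup>+z. ennreal ((w \<bullet> fst z - snd z)\<^sup>2) \<partial>D)
        = (\<integral>\<^sup>+z. ennreal ((w \<bullet> fst z - snd z)\<^sup>2) \<partial>distr ?P D (\<lambda>z. z k))"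
      by (simp only:)
    also have "\<dots> = (\<integral>\<^sup>+z. ennreal ((w \<bullet> fst (z k) - snd (z k))\<^sup>2) \<partial>?P)"
      by (rule nn_integral_distr[OF measurable_component_singleton[OF that]]) measurable
    finally show ?thesis by (rule sym)
  qed
  have "of_nat (card I) * (\<integral>\<^sup>+z. loo_loss I i z \<partial>?P) = (\<Sum>k\<in>I. \<integral>\<^sup>+z. loo_loss I i z \<partial>?P)"
    by simp
  also have "\<dots> = (\<Sum>k\<in>I. \<integral>\<^sup>+z. loo_loss I k z \<partial>?P)"
    by (intro sum.cong refl loo_loss_exchangeable assms)
  also have "\<dots> \<le> (\<Sum>k\<in>I. \<integral>\<^sup>+z. ?F k z + ?H k z \<partial>?P)"
    by (intro sum_mono loo_loss_le assms(1))
  also have "\<dots> = (\<integral>\<^sup>+z. (\<Sum>k\<in>I. ?F k z + ?H k z) \<partial>?P)"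
    by (rule nn_integral_sum[symmetric]) measurable
  also have "\<dots> \<le> (\<integral>\<^sup>+z. (\<Sum>k\<in>I. ennreal ((w \<bullet> fst (z k) - snd (z k))\<^sup>2)) + ennreal (8 * m\<^sup>2 * real CARD('d)) \<partial>?P)"
  proof (rule nn_integral_mono)
    fix z :: "'a \<Rightarrow> (real^'d) \<times> real"
    have "(\<Sum>k\<in>I. ?H k z) = (\<Sum>k\<in>I. ennreal (8 * m\<^sup>2 * leverage I (\<lambda>j. fst (z j)) k))"
      using leverage_bounds(1)[OF assms(1)] by (intro sum.cong refl ennreal_mult[symmetric]) simp_all
    also have "\<dots> = ennreal (\<Sum>k\<in>I. 8 * m\<^sup>2 * leverage I (\<lambda>j. fst (z j)) k)"
      using leverage_bounds(1)[OF assms(1)] by (intro sum_ennreal mult_nonneg_nonneg) auto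
    also have "\<dots> = ennreal (8 * m\<^sup>2 * (\<Sum>k\<in>I. leverage I (\<lambda>j. fst (z j)) k))"
      by (simp only: sum_distrib_left)
    also have "\<dots> \<le> ennreal (8 * m\<^sup>2 * real CARD('d))"
      by (intro ennreal_leI mult_left_mono sum_leverage_le) simp
    finally have "(\<Sum>k\<in>I. ?H k z) \<le> ennreal (8 * m\<^sup>2 * real CARD('d))" .
    moreover have "(\<Sum>k\<in>I. ?F k z) \<le> (\<Sum>k\<in>I. ennreal ((w \<bullet> fst (z k) - snd (z k))\<^sup>2))"
      by (simp add: ls_coeff_optimal[OF assms(1)] ennreal_leI)
    ultimately show "(\<Sum>k\<in>I. ?F k z + ?H k z)
        \<le> (\<Sum>k\<in>I. ennreal ((w \<bullet> fst (z k) - snd (z k))\<^sup>2)) + ennreal (8 * m\<^sup>2 * real CARD('d))"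
      unfolding sum.distrib by (rule add_mono[rotated])
  qed
  also have "\<dots> = (\<Sum>k\<in>I. \<integral>\<^sup>+z. ennreal ((w \<bullet> fst (z k) - snd (z k))\<^sup>2) \<partial>?P) + ennreal (8 * m\<^sup>2 * real CARD('d))"
    by (subst nn_integral_add, measurable) (simp add: nn_integral_sum P.emeasure_space_1 del: sum_ennreal)
  also have "\<dots> = of_nat (card I) * (\<integral>\<^sup>+z. ennreal ((w \<bullet> fst z - snd z)\<^sup>2) \<partial>D) + ennreal (8 * m\<^sup>2 * real CARD('d))"
    by (simp add: marginal)
  finally show ?thesis .
qed

end

subsection \<open>Reduction to the leave-one-out errors\<close>

theorem theorem1:
  fixes M :: "'a measure"
    and X :: "'a \<Rightarrow> real^'d" and Y :: "'a \<Rightarrow> real"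
    and Xs :: "nat \<Rightarrow> 'a \<Rightarrow> real^'d" and Ys :: "nat \<Rightarrow> 'a \<Rightarrow> real"
    and \<phi> :: "real^'d \<Rightarrow> ennreal"
    and n :: nat and m :: real
  assumes "n \<ge> 1" and "m > 0"
    and "prob_space M"
    and "X \<in> borel_measurable M" and "Y \<in> borel_measurable M"
    and "cond_exp_version M X (\<lambda>\<omega>. ennreal ((Y \<omega>)\<^sup>2)) \<phi>"
    and "(SUP x. \<phi> x) \<le> ennreal (m\<^sup>2)"
    and "\<And>i. i \<in> {1..n} \<Longrightarrow>
           distr M borel (\<lambda>\<omega>. (Xs i \<omega>, Ys i \<omega>)) = distr M borel (\<lambda>\<omega>. (X \<omega>, Y \<omega>))"
    and "prob_space.indep_vars M (\<lambda>_. borel)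
           (\<lambda>i \<omega>. if i = 0 then (X \<omega>, Y \<omega>) else (Xs i \<omega>, Ys i \<omega>)) {0..n}"
  shows "enn2ereal (\<integral>\<^sup>+ \<omega>. risk M X Y (truncated_ls m n (\<lambda>i. Xs i \<omega>) (\<lambda>i. Ys i \<omega>)) \<partial>M)
           - enn2ereal (INF f\<in>linear_class. risk M X Y f)
         \<le> ereal (8 * m\<^sup>2 * real CARD('d) / (real n + 1))"
proof -
  note [measurable] = assms(4,5)
  interpret M: prob_space M by fact
  define D where "D = distr M borel (\<lambda>\<omega>. (X \<omega>, Y \<omega>))"
  interpret bounded_second_moment D m
    unfolding D_def by (rule bounded_second_moment_distr) fact+
  interpret product_sigma_finite "\<lambda>_. D" by (rule product_sigma_finite_sample)
  let ?I = "{0..n}" and ?J = "{1..n}"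
  \<comment> \<open>Index 0 is the test pair, so the extended sample has n + 1 members, the
    denominator of the final bound.\<close>
  define Z where "Z i \<omega> = (if i = 0 then (X \<omega>, Y \<omega>) else (Xs i \<omega>, Ys i \<omega>))" for i :: nat and \<omega>
  have I: "?I = insert 0 ?J" "0 \<notin> ?J" "finite ?J" by auto
  have risk_eq: "risk M X Y g = (\<integral>\<^sup>+z. ennreal ((g (fst z) - snd z)\<^sup>2) \<partial>D)"
    if [measurable]: "g \<in> borel_measurable borel" for g
    unfolding risk_def D_def by (subst nn_integral_distr) simp_all
  have indep: "M.indep_vars (\<lambda>_. borel) Z ?J"
    using M.indep_vars_subset[OF assms(9), of ?J] by (simp add: Z_def[abs_def])
  have Z_meas: "Z i \<in> borel_measurable M" if "i \<in> ?J" for i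
    using indep that by (simp add: M.indep_vars_def2)
  have Z_distr: "distr M borel (Z i) = D" if "i \<in> ?J" for i
    using assms(8)[OF that] that by (simp add: Z_def[abs_def] D_def)
  define S where "S \<omega> = (\<lambda>i\<in>?J. Z i \<omega>)" for \<omega>
  have "distr M (PiM ?J (\<lambda>_. borel)) S = PiM ?J (\<lambda>i. distr M borel (Z i))"
    using M.indep_vars_iff_distr_eq_PiM'[where I = ?J and M' = "\<lambda>_. borel" and X = Z] indep Z_meas assms(1)
    by (simp add: S_def[abs_def])
  also have "\<dots> = PiM ?J (\<lambda>_. D)"
    by (intro PiM_cong refl Z_distr)
  also have "distr M (PiM ?J (\<lambda>_. borel)) S = distr M (PiM ?J (\<lambda>_. D)) S"
    by (intro distr_cong refl sets_PiM_cong) (simp_all add: sets_D)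
  finally have S_distr: "distr M (PiM ?J (\<lambda>_. D)) S = PiM ?J (\<lambda>_. D)" .
  have S_meas: "S \<in> M \<rightarrow>\<^sub>M PiM ?J (\<lambda>_. D)"
    unfolding S_def using Z_meas sets_D by (intro measurable_restrict) (simp cong: measurable_cong_sets)
  have loss_meas: "(\<lambda>(r, z). loo_loss ?I 0 (r(0 := z))) \<in> borel_measurable (PiM ?J (\<lambda>_. D) \<Otimes>\<^sub>M D)"
    using measurable_compose[OF measurable_add_dim[of 0 ?J "\<lambda>_. D"] measurable_loo_loss[of ?I 0, unfolded I(1)]] I
    by (simp add: split_beta')
  have inner_meas: "(\<lambda>r. \<integral>\<^sup>+z. loo_loss ?I 0 (r(0 := z)) \<partial>D) \<in> borel_measurable (PiM ?J (\<lambda>_. D))"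
    using loss_meas by (rule borel_measurable_nn_integral)
  let ?E = "\<integral>\<^sup>+ \<omega>. risk M X Y (truncated_ls m n (\<lambda>i. Xs i \<omega>) (\<lambda>i. Ys i \<omega>)) \<partial>M"
  \<comment> \<open>The risk given the sample integrates a fresh pair placed in coordinate 0;
    averaging over the product law of \<open>S\<close> then gives the leave-one-out error of
    observation 0.\<close>
  have "risk M X Y (truncated_ls m n (\<lambda>i. Xs i \<omega>) (\<lambda>i. Ys i \<omega>)) = (\<integral>\<^sup>+z. loo_loss ?I 0 ((S \<omega>)(0 := z)) \<partial>D)" for \<omega>
  proof -
    have "ls_coeff ?J (\<lambda>i. fst (S \<omega> i)) (\<lambda>i. snd (S \<omega> i)) = ls_coeff ?J (\<lambda>i. Xs i \<omega>) (\<lambda>i. Ys i \<omega>)"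
      by (intro ls_coeff_cong) (auto simp: S_def Z_def)
    then show ?thesis
      unfolding I(1) loo_loss_fun_upd[OF I(2)] by (simp add: risk_eq truncated_ls_eq_clip[abs_def])
  qed
  then have "?E = (\<integral>\<^sup>+\<omega>. (\<integral>\<^sup>+z. loo_loss ?I 0 ((S \<omega>)(0 := z)) \<partial>D) \<partial>M)"
    by simp
  also have "\<dots> = (\<integral>\<^sup>+r. (\<integral>\<^sup>+z. loo_loss ?I 0 (r(0 := z)) \<partial>D) \<partial>distr M (PiM ?J (\<lambda>_. D)) S)"
    by (rule nn_integral_distr[OF S_meas, symmetric]) (use inner_meas in simp)
  also have "\<dots> = (\<integral>\<^sup>+z. loo_loss ?I 0 z \<partial>PiM ?I (\<lambda>_. D))"
    unfolding S_distr I(1)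
    by (rule product_nn_integral_insert[OF I(3,2), symmetric]) (rule measurable_loo_loss, auto)
  finally have E_eq: "?E = (\<integral>\<^sup>+z. loo_loss ?I 0 z \<partial>PiM ?I (\<lambda>_. D))" .
  define c where "c = 8 * m\<^sup>2 * real CARD('d) / (real n + 1)"
  have c: "0 \<le> c" by (simp add: c_def)
  have E_le: "?E \<le> risk M X Y f + ennreal c" if lin: "f \<in> linear_class" for f
  proof -
    obtain w where f: "f = (\<lambda>x. w \<bullet> x)" using lin by (auto simp: linear_class_def)
    let ?N = "real n + 1"
    have N: "of_nat (card ?I) = ennreal ?N" by (simp add: ennreal_of_nat_eq_real_of_nat add.commute)
    have inv: "ennreal (1 / ?N) * (ennreal ?N * a) = a" for a
    proof -
      have "ennreal (1 / ?N) * ennreal ?N = 1" by (subst ennreal_mult[symmetric]) simp_all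
      then show ?thesis by (simp only: mult.assoc[symmetric] mult_1_left)
    qed
    have "ennreal ?N * ?E \<le> ennreal ?N * risk M X Y f + ennreal (8 * m\<^sup>2 * real CARD('d))"
      using card_mult_loo_loss_le[of ?I 0 w] unfolding E_eq f N by (simp add: risk_eq)
    then have "ennreal (1 / ?N) * (ennreal ?N * ?E)
        \<le> ennreal (1 / ?N) * (ennreal ?N * risk M X Y f + ennreal (8 * m\<^sup>2 * real CARD('d)))"
      by (intro mult_left_mono) simp_all
    also have "\<dots> = risk M X Y f + ennreal c"
      unfolding distrib_left inv by (simp add: c_def flip: ennreal_mult)
    finally show ?thesis by (simp only: inv)
  qed
  \<comment> \<open>The zero predictor has risk at most m^2, so the infimum is finite. The bound on
    \<open>?E\<close> makes the expected risk finite too, and the extended difference becomes one of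
    real numbers.\<close>
  have zero: "(\<lambda>x. 0 \<bullet> x) \<in> (linear_class :: (real^'d \<Rightarrow> real) set)"
    unfolding linear_class_def by (rule rangeI)
  have "(INF f\<in>linear_class. risk M X Y f) \<le> risk M X Y (\<lambda>x. 0 \<bullet> x)"
    by (rule INF_lower[OF zero])
  also have "\<dots> \<le> ennreal (m\<^sup>2)"
    using second_moment_le by (simp add: risk_eq)
  finally have "(INF f\<in>linear_class. risk M X Y f) < \<top>"
    by (simp add: le_less_trans)
  then obtain r where r: "0 \<le> r" "(INF f\<in>linear_class. risk M X Y f) = ennreal r"
    by (cases "INF f\<in>linear_class. risk M X Y f") auto
  have "?E - ennreal c \<le> (INF f\<in>linear_class. risk M X Y f)"
    using E_le by (intro INF_greatest) (simp add: ennreal_minus_le_iff add.commute)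
  then have "?E \<le> (INF f\<in>linear_class. risk M X Y f) + ennreal c"
    by (simp add: ennreal_minus_le_iff add.commute)
  also have "\<dots> = ennreal (r + c)"
    using r c by simp
  finally have *: "?E \<le> ennreal (r + c)" .
  then obtain s where s: "0 \<le> s" "?E = ennreal s"
    by (cases ?E) (auto simp: top_unique)
  then have "s \<le> r + c" using * r(1) c unfolding s(2) by (simp del: ennreal_plus)
  then show ?thesis
    unfolding s r c_def[symmetric] using s(1) r(1) by (simp add: enn2ereal_ennreal)
qed

end
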